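(* Let $\mathcal{H}\subset\mathbb{R}^{n_1}\times\cdots\times\mathbb{R}^{n_k}$ be a bounded axis-aligned region, and for each $i\in[m]$ let $M_i:\mathcal{H}\to\mathbb{R}$ be a multilinear function. Then the simultaneous hull of $\{M_i\}_{i\in[m]}$, $$\operatorname{conv}\bigl\{\bigl(x,M_1(x),\ldots,M_m(x)\bigr) : x\in\mathcal{H}\bigr\},$$ is the convex hull of the set $$\bigl\{\bigl(v,M_1(v),\ldots,M_m(v)\bigr) : v\in\operatorname{corner}(\mathcal{H})\bigr\}.$$
   Context: $[m]=\{1,\ldots,m\}$. A subset $\mathcal{H}$ of $\mathbb{R}^{n_1}\times\cdots\times\mathbb{R}^{n_k}$ is axis-aligned if it can be written as a finite union $\bigcup_{i=1}^n\prod_{j=1}^kP_{ij}$, where each $P_{ij}$ is a polytope in $\mathbb{R}^{n_j}$. Points are written in blocks $x=(x_1,\ldots,x_k)$ with $x_j\in\mathbb{R}^{n_j}$. A point $v=(v_1,\ldots,v_k)$ is a corner point of $\mathcal{H}$ if for each $j\in[k]$ the vector $v_j$ is an extreme point of $\operatorname{conv}\{x_j : x\in\mathcal{H},\ x_{j'}=v_{j'}\text{ for all } j'\in[k]\setminus\{j\}\}$; the set of corner points is $\operatorname{corner}(\mathcal{H})$. A multilinear function is one that is affine in each block $x_j\in\mathbb{R}^{n_j}$ when the other blocks are fixed (a function $\mathcal{H}\to\mathbb{R}$ is called multilinear if it is the restriction of such a function on the whole space). *)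

theory Defs
  imports "HOL-Analysis.Analysis"
begin

text \<open>
  The Euclidean block spaces may have different dimensions, so the \<open>j\<close>-th one is rendered as
  the coordinate subspace of \<open>real^'n\<close> given by a set \<open>I j\<close> of coordinates; its dimension is
  \<open>card (I j)\<close> (possibly \<open>0\<close>). Points of the product are vectors of blocks, of type
  \<open>real^'n^'k\<close>, with \<open>x $ j\<close> the \<open>j\<close>-th block. Taking \<open>'n\<close> large enough, every finite
  sequence of dimensions arises from a suitable \<open>I\<close>.
\<close>

definition block_space :: "('k::finite \<Rightarrow> 'n::finite set) \<Rightarrow> 'k \<Rightarrow> (real^'n) set" where
  "block_space I j = {y. \<forall>i. i \<notin> I j \<longrightarrow> y $ i = 0}"

definition whole_space :: "('k::finite \<Rightarrow> 'n::finite set) \<Rightarrow> (real^'n^'k) set" where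
  "whole_space I = {x. \<forall>j. x $ j \<in> block_space I j}"

definition axis_aligned :: "('k::finite \<Rightarrow> 'n::finite set) \<Rightarrow> (real^'n^'k) set \<Rightarrow> bool" where
  "axis_aligned I H \<longleftrightarrow>
     (\<exists>(n::nat) (P :: nat \<Rightarrow> 'k \<Rightarrow> (real^'n) set).
        (\<forall>i\<in>{1..n}. \<forall>j. polytope (P i j) \<and> P i j \<subseteq> block_space I j) \<and>
        H = (\<Union>i\<in>{1..n}. {x. \<forall>j. x $ j \<in> P i j}))"

definition slice :: "(real^'n::finite^'k::finite) set \<Rightarrow> real^'n^'k \<Rightarrow> 'k \<Rightarrow> (real^'n) set" where
  "slice H v j = {x $ j | x. x \<in> H \<and> (\<forall>j'. j' \<noteq> j \<longrightarrow> x $ j' = v $ j')}"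

text \<open>
  For \<open>H \<subseteq> whole_space I\<close> corner points lie in \<open>whole_space I\<close> automatically, since an extreme
  point of a set belongs to it.
\<close>

definition corner :: "(real^'n::finite^'k::finite) set \<Rightarrow> (real^'n^'k) set" where
  "corner H = {v. \<forall>j. (v $ j) extreme_point_of (convex hull (slice H v j))}"

definition replace_block :: "real^'n::finite^'k::finite \<Rightarrow> 'k \<Rightarrow> real^'n \<Rightarrow> real^'n^'k" where
  "replace_block x j y = (\<chi> j'. if j' = j then y else x $ j')"

definition affine_fun_on :: "(real^'n::finite) set \<Rightarrow> (real^'n \<Rightarrow> real) \<Rightarrow> bool" where
  "affine_fun_on S f \<longleftrightarrow> (\<exists>g c. linear g \<and> (\<forall>y\<in>S. f y = g y + c))"

definition multilinear :: "('k::finite \<Rightarrow> 'n::finite set) \<Rightarrow> (real^'n^'k \<Rightarrow> real) \<Rightarrow> bool" where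
  "multilinear I F \<longleftrightarrow>
     (\<forall>x\<in>whole_space I. \<forall>j. affine_fun_on (block_space I j) (\<lambda>y. F (replace_block x j y)))"

definition multilinear_on ::
  "('k::finite \<Rightarrow> 'n::finite set) \<Rightarrow> (real^'n^'k) set \<Rightarrow> (real^'n^'k \<Rightarrow> real) \<Rightarrow> bool" where
  "multilinear_on I H M \<longleftrightarrow> (\<exists>F. multilinear I F \<and> (\<forall>x\<in>H. M x = F x))"

end

theory Submission
  imports Defs
begin

text \<open>
  Let \<open>G x = (x, F x)\<close> where \<open>F\<close> collects multilinear extensions of the given functions to the
  whole space, and let \<open>C\<close> be the convex hull of \<open>G ` H\<close>. When all blocks but one are fixed, \<open>G\<close>
  is an affine map of the remaining block (lemma \<open>graph_affine_in_block\<close>). This has two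
  consequences.

  First, moving the blocks one at a time, the graph over a product of polytopes lies in the hull of
  the graph over the product of their (finite) vertex sets (lemma \<open>graph_of_product_in_hull\<close>).
  Hence \<open>C\<close> is the hull of a finite set, so it is compact, and by Minkowski's theorem it is the
  hull of its extreme points. These all have the form \<open>G v\<close> with \<open>v \<in> H\<close>.

  Second, if \<open>G v\<close> is an extreme point of \<open>C\<close>, then \<open>v\<close> is a corner point (lemma
  \<open>extreme_graph_point_corner\<close>): were some block \<open>v $ j\<close> strictly between two points of
  the hull of the slice through \<open>v\<close>, the injective affine map of the \<open>j\<close>-th block would put
  \<open>G v\<close> strictly between two points of \<open>C\<close>.

  Hence \<open>C\<close> is contained in the hull of the graph over the corner points; the other inclusion holds
  because corner points belong to \<open>H\<close>.
\<close>

lemma replace_block_self [simp]: "replace_block x j (x $ j) = x"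
  by (simp add: replace_block_def vec_eq_iff)

lemma replace_block_nth:
  "replace_block x j y $ j' = (if j' = j then y else x $ j')"
  by (simp add: replace_block_def)

lemma convex_block_space: "convex (block_space I j)"
  by (auto simp: convex_alt block_space_def)

lemma affine_image_hull_in_convex:
  assumes "linear L" "convex C" "\<And>s. s \<in> S \<Longrightarrow> L s + c \<in> C" "y \<in> convex hull S"
  shows "L y + c \<in> C"
proof -
  have "(\<lambda>y. L y + c) ` (convex hull S) = (\<lambda>z. c + z) ` (convex hull (L ` S))"
    using assms(1) by (simp add: convex_hull_linear_image [symmetric] image_image add.commute)
  also have "\<dots> = convex hull ((\<lambda>z. c + z) ` L ` S)"
    by (rule convex_hull_translation [symmetric])
  also have "\<dots> \<subseteq> C"
    by (rule hull_minimal) (use assms(2,3) in \<open>auto simp: add.commute\<close>)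
  finally show ?thesis
    using assms(4) by auto
qed

text \<open>
  The last conclusion, valid off the block space as well, shows that \<open>\<lambda>y. L y + c\<close> is injective.
\<close>

lemma graph_affine_in_block:
  fixes I :: "'k::finite \<Rightarrow> 'n::finite set"
    and F :: "'m::finite \<Rightarrow> real^'n^'k \<Rightarrow> real"
  assumes F: "\<And>i. multilinear I (F i)" and x: "x \<in> whole_space I"
  obtains L :: "real^'n \<Rightarrow> (real^'n^'k) \<times> (real^'m)" and c where
    "linear L"
    "\<And>y. y \<in> block_space I j \<Longrightarrow>
        (replace_block x j y, \<chi> i. F i (replace_block x j y)) = L y + c"
    "\<And>y. fst (L y + c) = replace_block x j y"
proof -
  have "\<forall>i. \<exists>g d. linear g \<and> (\<forall>y\<in>block_space I j. F i (replace_block x j y) = g y + d)"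
    using F x unfolding multilinear_def affine_fun_on_def by blast
  then obtain g d where g: "\<And>i. linear (g i)"
    and gd: "\<And>i y. y \<in> block_space I j \<Longrightarrow> F i (replace_block x j y) = g i y + d i"
    by metis
  let ?L = "\<lambda>y. ((\<chi> j'. if j' = j then y else 0) :: real^'n^'k, (\<chi> i. g i y) :: real^'m)"
  let ?c = "(replace_block x j 0, \<chi> i. d i)"
  have "linear ?L"
    by (rule linearI)
       (auto simp: vec_eq_iff linear_add [OF g] linear_scale [OF g])
  moreover have "(replace_block x j y, \<chi> i. F i (replace_block x j y)) = ?L y + ?c"
    if "y \<in> block_space I j" for y
    using gd [OF that] by (auto simp: vec_eq_iff replace_block_def)
  moreover have "fst (?L y + ?c) = replace_block x j y" for y
    by (auto simp: vec_eq_iff replace_block_def)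
  ultimately show ?thesis
    by (rule that)
qed

text \<open>
  The set \<open>S\<close> consists of the blocks that are not known to be vertices; the case \<open>S = UNIV\<close>
  is the one of interest, and smaller \<open>S\<close> make the induction on \<open>S\<close> possible.
\<close>

lemma graph_of_product_in_hull:
  fixes I :: "'k::finite \<Rightarrow> 'n::finite set"
    and F :: "'m::finite \<Rightarrow> real^'n^'k \<Rightarrow> real"
    and V :: "'k \<Rightarrow> (real^'n) set"
  assumes F: "\<And>i. multilinear I (F i)"
    and V: "\<And>j. V j \<subseteq> block_space I j"
    and C: "convex C" "\<And>v. (\<And>j. v $ j \<in> V j) \<Longrightarrow> (v, \<chi> i. F i v) \<in> C"
    and x: "\<And>j. j \<in> S \<Longrightarrow> x $ j \<in> convex hull V j" "\<And>j. j \<notin> S \<Longrightarrow> x $ j \<in> V j"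
  shows "(x, \<chi> i. F i x) \<in> C"
proof -
  have hull_V: "convex hull V j \<subseteq> block_space I j" for j
    using V by (rule hull_minimal) (rule convex_block_space)
  have "finite S" by simp
  then show ?thesis
    using x
  proof (induction S arbitrary: x)
    case empty
    then show ?case using C(2) by simp
  next
    case (insert j S)
    have xj: "x $ j \<in> convex hull V j"
      using insert.prems(1) by simp
    have "x $ j' \<in> block_space I j'" for j'
      using insert.prems hull_V V by (cases "j' \<in> insert j S") blast+
    then have xI: "x \<in> whole_space I"
      by (simp add: whole_space_def)
    obtain L :: "real^'n \<Rightarrow> (real^'n^'k) \<times> (real^'m)" and c where L: "linear L"
      and Lc: "\<And>y. y \<in> block_space I j \<Longrightarrow>
        (replace_block x j y, \<chi> i. F i (replace_block x j y)) = L y + c"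
      by (rule graph_affine_in_block [where F = F and j = j, OF F xI], rule that)
    have "L s + c \<in> C" if s: "s \<in> V j" for s
    proof -
      have "(replace_block x j s, \<chi> i. F i (replace_block x j s)) \<in> C"
      proof (rule insert.IH)
        show "replace_block x j s $ j' \<in> convex hull V j'" if "j' \<in> S" for j'
          using that insert.prems insert.hyps by (auto simp: replace_block_nth)
        show "replace_block x j s $ j' \<in> V j'" if "j' \<notin> S" for j'
          using that insert.prems s by (auto simp: replace_block_nth)
      qed
      then show ?thesis
        by (simp only: Lc [OF subsetD [OF V s]])
    qed
    then have "L (x $ j) + c \<in> C"
      using affine_image_hull_in_convex [OF L C(1) _ xj] by blast
    then show ?case
      using Lc [OF subsetD [OF hull_V xj]] by simp
  qed
qed

lemma slice_iff: "y \<in> slice H v j \<longleftrightarrow> replace_block v j y \<in> H"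
proof
  assume "y \<in> slice H v j"
  then obtain x where x: "x \<in> H" "y = x $ j" "\<And>j'. j' \<noteq> j \<Longrightarrow> x $ j' = v $ j'"
    by (auto simp: slice_def)
  then have "replace_block v j y = x"
    by (auto simp: vec_eq_iff replace_block_def)
  with x show "replace_block v j y \<in> H" by simp
next
  assume "replace_block v j y \<in> H"
  then show "y \<in> slice H v j"
    unfolding slice_def by (force simp: replace_block_nth)
qed

lemma corner_subset: "corner H \<subseteq> H"
proof
  fix v assume "v \<in> corner H"
  \<comment> \<open>Any one block suffices; there is one since types are nonempty.\<close>
  then have "v $ undefined \<in> slice H v undefined"
    using extreme_point_of_convex_hull by (auto simp: corner_def)
  then show "v \<in> H"
    by (simp add: slice_iff)
qed

lemma extreme_graph_point_corner:
  fixes I :: "'k::finite \<Rightarrow> 'n::finite set"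
    and F :: "'m::finite \<Rightarrow> real^'n^'k \<Rightarrow> real"
  assumes F: "\<And>i. multilinear I (F i)"
    and H: "H \<subseteq> whole_space I" and v: "v \<in> H"
    and ext: "(v, \<chi> i. F i v) extreme_point_of (convex hull ((\<lambda>x. (x, \<chi> i. F i x)) ` H))"
      (is "_ extreme_point_of ?C")
  shows "v \<in> corner H"
  unfolding corner_def extreme_point_of_def
proof (safe)
  fix j
  have "v $ j \<in> slice H v j"
    using v by (simp add: slice_iff)
  then show "v $ j \<in> convex hull slice H v j"
    by (rule hull_inc)
next
  fix j a b
  assume a: "a \<in> convex hull slice H v j" and b: "b \<in> convex hull slice H v j"
    and ab: "v $ j \<in> open_segment a b"
  have vI: "v \<in> whole_space I" using v H by blast
  obtain L :: "real^'n \<Rightarrow> (real^'n^'k) \<times> (real^'m)" and c where L: "linear L"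
    and Lc: "\<And>y. y \<in> block_space I j \<Longrightarrow>
        (replace_block v j y, \<chi> i. F i (replace_block v j y)) = L y + c"
    and fst_L: "\<And>y. fst (L y + c) = replace_block v j y"
    by (rule graph_affine_in_block [where F = F and j = j, OF F vI], rule that)
  have slice_C: "L s + c \<in> ?C" if "s \<in> slice H v j" for s
  proof -
    have s: "replace_block v j s \<in> H"
      using that by (simp add: slice_iff)
    then have "replace_block v j s $ j \<in> block_space I j"
      using H by (auto simp: whole_space_def)
    then have "s \<in> block_space I j"
      by (simp add: replace_block_nth)
    then have "L s + c = (replace_block v j s, \<chi> i. F i (replace_block v j s))"
      by (rule Lc [symmetric])
    then show ?thesis
      using s by (auto intro: hull_inc)
  qed
  have hull_C: "L y + c \<in> ?C" if "y \<in> convex hull slice H v j" for y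
    by (rule affine_image_hull_in_convex [OF L convex_convex_hull slice_C that])
  have Gv: "(v, \<chi> i. F i v) = L (v $ j) + c"
    using Lc [of "v $ j"] vI by (simp add: whole_space_def)
  obtain u where u: "0 < u" "u < 1" "v $ j = (1 - u) *\<^sub>R a + u *\<^sub>R b" and "a \<noteq> b"
    using ab by (auto simp: in_segment)
  have "L (v $ j) + c = (1 - u) *\<^sub>R (L a + c) + u *\<^sub>R (L b + c)"
    unfolding u(3) linear_add [OF L] linear_scale [OF L] by (simp add: algebra_simps)
  moreover have "L a + c \<noteq> L b + c"
    using fst_L [of a] fst_L [of b] \<open>a \<noteq> b\<close> by (metis replace_block_nth)
  ultimately have "(v, \<chi> i. F i v) \<in> open_segment (L a + c) (L b + c)"
    using u Gv by (auto simp: in_segment)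
  then show False
    using ext hull_C [OF a] hull_C [OF b] by (auto simp: extreme_point_of_def)
qed

lemma axis_aligned_subset_whole_space: "axis_aligned I H \<Longrightarrow> H \<subseteq> whole_space I"
  unfolding axis_aligned_def whole_space_def by fastforce

lemma finite_vec_product:
  fixes V :: "'k::finite \<Rightarrow> 'a set"
  assumes "\<And>j. finite (V j)"
  shows "finite {x :: 'a^'k. \<forall>j. x $ j \<in> V j}"
proof (rule finite_subset)
  show "{x :: 'a^'k. \<forall>j. x $ j \<in> V j} \<subseteq> vec_lambda ` PiE UNIV V"
  proof
    fix x :: "'a^'k" assume "x \<in> {x. \<forall>j. x $ j \<in> V j}"
    then have "vec_nth x \<in> PiE UNIV V" by auto
    then have "vec_lambda (vec_nth x) \<in> vec_lambda ` PiE UNIV V" by (rule imageI)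
    then show "x \<in> vec_lambda ` PiE UNIV V" by simp
  qed
  show "finite (vec_lambda ` PiE UNIV V :: ('a^'k) set)"
    using assms by (intro finite_imageI finite_PiE) auto
qed

lemma compact_hull_graph:
  fixes I :: "'k::finite \<Rightarrow> 'n::finite set"
    and F :: "'m::finite \<Rightarrow> real^'n^'k \<Rightarrow> real"
  assumes F: "\<And>i. multilinear I (F i)" and H: "axis_aligned I H"
  shows "compact (convex hull ((\<lambda>x. (x, (\<chi> i. F i x) :: real^'m)) ` H))"
proof -
  let ?G = "\<lambda>x. (x, (\<chi> i. F i x) :: real^'m)"
  obtain n and P :: "nat \<Rightarrow> 'k \<Rightarrow> (real^'n) set" where
    P: "\<And>i j. i \<in> {1..n} \<Longrightarrow> polytope (P i j)"
       "\<And>i j. i \<in> {1..n} \<Longrightarrow> P i j \<subseteq> block_space I j"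
    and HP: "H = (\<Union>i\<in>{1..n}. {x. \<forall>j. x $ j \<in> P i j})"
    using H unfolding axis_aligned_def by blast
  have "\<forall>i\<in>{1..n}. \<forall>j. \<exists>W. finite W \<and> P i j = convex hull W"
    using P(1) by (auto simp: polytope_def)
  then obtain V where V: "\<And>i j. i \<in> {1..n} \<Longrightarrow> finite (V i j)"
      "\<And>i j. i \<in> {1..n} \<Longrightarrow> P i j = convex hull V i j"
    by metis
  have VP: "V i j \<subseteq> P i j" if "i \<in> {1..n}" for i j
    using V(2) [OF that] by (simp add: hull_subset)
  define W where "W = (\<Union>i\<in>{1..n}. {x :: real^'n^'k. \<forall>j. x $ j \<in> V i j})"
  have fin: "finite W"
    unfolding W_def using V(1) by (intro finite_UN_I finite_atLeastAtMost finite_vec_product)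
  have WH: "W \<subseteq> H"
    unfolding W_def HP using VP by blast
  have "?G x \<in> convex hull (?G ` W)" if "x \<in> H" for x
  proof -
    obtain i where i: "i \<in> {1..n}" and x: "\<And>j. x $ j \<in> P i j"
      using \<open>x \<in> H\<close> unfolding HP by blast
    show ?thesis
    proof (rule graph_of_product_in_hull [OF F, where V = "V i" and S = UNIV])
      show "V i j \<subseteq> block_space I j" for j
        using VP [OF i] P(2) [OF i] by blast
      show "?G v \<in> convex hull (?G ` W)" if "\<And>j. v $ j \<in> V i j" for v
        by (intro hull_inc imageI) (use that i in \<open>unfold W_def, blast\<close>)
      show "x $ j \<in> convex hull V i j" for j
        using x V(2) [OF i] by blast
    qed auto
  qed
  then have "convex hull (?G ` H) = convex hull (?G ` W)"
    using WH by (intro subset_antisym hull_minimal hull_mono image_mono) auto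
  then show ?thesis
    using fin by (simp add: finite_imp_compact_convex_hull)
qed

theorem theorem7:
  fixes I :: "'k::finite \<Rightarrow> 'n::finite set"
    and H :: "(real^'n^'k) set"
    and M :: "'m::finite \<Rightarrow> real^'n^'k \<Rightarrow> real"
  assumes "axis_aligned I H"
    and "bounded H"
    and "\<And>i. multilinear_on I H (M i)"
  shows "convex hull {(x, (\<chi> i. M i x) :: real^'m) | x. x \<in> H} =
         convex hull {(v, (\<chi> i. M i v) :: real^'m) | v. v \<in> corner H}"
proof -
  obtain F where F: "\<And>i. multilinear I (F i)" and MF: "\<And>i x. x \<in> H \<Longrightarrow> M i x = F i x"
    using assms(3) unfolding multilinear_on_def by metis
  let ?G = "\<lambda>x. (x, (\<chi> i. F i x) :: real^'m)"
  have graph: "{(x, (\<chi> i. M i x) :: real^'m) | x. x \<in> A} = ?G ` A" if "A \<subseteq> H" for A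
    using that MF by (force simp: image_iff)
  have ext: "z \<in> ?G ` corner H" if z: "z extreme_point_of (convex hull (?G ` H))" for z
  proof -
    have "z \<in> ?G ` H"
      using z by (rule extreme_point_of_convex_hull)
    then obtain v where v: "v \<in> H" "z = ?G v" by blast
    then have "v \<in> corner H"
      using z extreme_graph_point_corner [OF F axis_aligned_subset_whole_space [OF assms(1)]]
      by simp
    with v show ?thesis by blast
  qed
  have "convex hull (?G ` H) =
      convex hull {z. z extreme_point_of (convex hull (?G ` H))}"
    by (intro Krein_Milman_Minkowski compact_hull_graph [OF F assms(1)] convex_convex_hull)
  also have "\<dots> \<subseteq> convex hull (?G ` corner H)"
    using ext by (intro hull_mono) blast
  finally have "convex hull (?G ` H) = convex hull (?G ` corner H)"
    using hull_mono [OF image_mono [OF corner_subset]] by (rule subset_antisym)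
  then show ?thesis
    by (simp only: graph [OF subset_refl] graph [OF corner_subset])
qed

end
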